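(* For every positive integer $n$, $B'(K_{n,n})=\binom{n+1}{2}-1$.
   Context: $K_{n,n}$ is the complete bipartite graph with both parts of size $n$. An edge-numbering of a graph $G$ is an assignment $f$ of distinct integers to the edges; $B'(f)$ is the maximum of $|f(e)-f(e')|$ over pairs of distinct incident edges $e,e'$. The edge-bandwidth $B'(G)$ is the minimum of $B'(f)$ over all edge-numberings $f$ of $G$. *)

theory Defs
  imports Complex_Main
begin

text \<open>Finite simple graphs are pairs of a vertex set and a set of two-element edges.\<close>

type_synonym 'a graph = "'a set \<times> 'a set set"

definition verts :: "'a graph \<Rightarrow> 'a set" where
  "verts G = fst G"

definition edges :: "'a graph \<Rightarrow> 'a set set" where
  "edges G = snd G"

definition finite_simple_graph :: "'a graph \<Rightarrow> bool" where
  "finite_simple_graph G \<longleftrightarrow>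
     finite (verts G) \<and> (\<forall>e \<in> edges G. e \<subseteq> verts G \<and> card e = 2)"

definition complete_bipartite :: "nat \<Rightarrow> nat \<Rightarrow> (nat + nat) graph" where
  "complete_bipartite m n =
     (Inl ` {..<m} \<union> Inr ` {..<n}, {{Inl i, Inr j} | i j. i < m \<and> j < n})"

definition edge_numbering :: "'a graph \<Rightarrow> ('a set \<Rightarrow> int) \<Rightarrow> bool" where
  "edge_numbering G f \<longleftrightarrow> inj_on f (edges G)"

definition incident_edges :: "'a set \<Rightarrow> 'a set \<Rightarrow> bool" where
  "incident_edges e e' \<longleftrightarrow> e \<noteq> e' \<and> e \<inter> e' \<noteq> {}"

text \<open>
  The value \<open>B'(f)\<close>. The inserted \<open>0\<close> only matters for a graph without distinct incident
  edges (such as a single edge), where the maximum of no differences is \<open>0\<close>.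
\<close>

definition numbering_width :: "'a graph \<Rightarrow> ('a set \<Rightarrow> int) \<Rightarrow> nat" where
  "numbering_width G f =
     Max (insert 0 {nat \<bar>f e - f e'\<bar> | e e'.
       e \<in> edges G \<and> e' \<in> edges G \<and> incident_edges e e'})"

definition edge_bandwidth :: "'a graph \<Rightarrow> nat" where
  "edge_bandwidth G = (LEAST k. \<exists>f. edge_numbering G f \<and> numbering_width G f = k)"

lemma finite_simple_graph_complete_bipartite:
  "finite_simple_graph (complete_bipartite m n)"
  by (auto simp: finite_simple_graph_def complete_bipartite_def verts_def edges_def)

lemma finite_edges: "finite_simple_graph G \<Longrightarrow> finite (edges G)"
  unfolding finite_simple_graph_def by (rule finite_subset[of _ "Pow (verts G)"]) auto

text \<open>The minimum ranges over a nonempty set, so it is attained.\<close>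

lemma edge_bandwidth_attained:
  assumes "finite_simple_graph G"
  shows "\<exists>f. edge_numbering G f \<and> numbering_width G f = edge_bandwidth G"
proof -
  obtain h :: "'a set \<Rightarrow> nat" where "inj_on h (edges G)"
    using finite_imp_inj_to_nat_seg[OF finite_edges[OF assms]] by blast
  then have "edge_numbering G (\<lambda>e. int (h e))"
    by (simp add: edge_numbering_def inj_on_def)
  then show ?thesis
    unfolding edge_bandwidth_def
    by (intro LeastI_ex[of "\<lambda>k. \<exists>f. edge_numbering G f \<and> numbering_width G f = k"]) blast
qed

end

theory Submission imports Defs begin

text \<open>
  Identify the edges with the cells of an \<open>n \<times> n\<close> board, two cells being incident iff they lie
  in a common row or column.

  Lower bound: let \<open>S\<close> consist of the \<open>l = \<lfloor>(n-1)\<^sup>2/4\<rfloor> + 1\<close> cells with the smallest labels, meeting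
  \<open>r\<close> rows and \<open>c\<close> columns. As \<open>r c \<ge> l\<close>, we have \<open>r + c \<ge> n\<close>, so at most \<open>\<lfloor>n\<^sup>2/4\<rfloor>\<close> cells avoid
  all these lines. The cell of largest label on these lines differs from an incident cell
  of \<open>S\<close> by at least \<open>n\<^sup>2 - \<lfloor>n\<^sup>2/4\<rfloor> - l = n(n+1)/2 - 1\<close>.

  Upper bound: with \<open>k = \<lfloor>n/2\<rfloor>\<close>, let \<open>A\<^sub>1\<close> be the first \<open>k\<close> rows and \<open>A\<^sub>2\<close> the others; let \<open>B\<^sub>1\<close>
  and \<open>B\<^sub>2\<close> be the first and last \<open>k\<close> columns and \<open>C\<close> the middle column if \<open>n\<close> is odd (empty
  otherwise). Number the blocks
  \<open>A\<^sub>1B\<^sub>1, A\<^sub>1C, A\<^sub>2B\<^sub>1, A\<^sub>1B\<^sub>2, A\<^sub>2C, A\<^sub>2B\<^sub>2\<close> in this order, each of them row by row.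
\<close>

section \<open>Edge sets, width bounds and quarter squares\<close>

lemma edges_complete_bipartite:
  "edges (complete_bipartite m n) = (\<lambda>(i, j). {Inl i, Inr j}) ` ({..<m} \<times> {..<n})"
  by (auto simp: edges_def complete_bipartite_def)

lemma numbering_width_le_iff:
  assumes "finite_simple_graph G"
  shows "numbering_width G f \<le> d \<longleftrightarrow>
    (\<forall>e \<in> edges G. \<forall>e' \<in> edges G. incident_edges e e' \<longrightarrow> \<bar>f e - f e'\<bar> \<le> int d)"
proof -
  let ?D = "{nat \<bar>f e - f e'\<bar> | e e'. e \<in> edges G \<and> e' \<in> edges G \<and> incident_edges e e'}"
  have "?D \<subseteq> (\<lambda>(e, e'). nat \<bar>f e - f e'\<bar>) ` (edges G \<times> edges G)"
    by auto
  then have "finite ?D"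
    using finite_edges[OF assms] by (meson finite_SigmaI finite_imageI finite_subset)
  then have "numbering_width G f \<le> d \<longleftrightarrow> (\<forall>x \<in> ?D. x \<le> d)"
    by (simp add: numbering_width_def)
  also have "\<dots> \<longleftrightarrow>
    (\<forall>e \<in> edges G. \<forall>e' \<in> edges G. incident_edges e e' \<longrightarrow> nat \<bar>f e - f e'\<bar> \<le> d)"
    by blast
  finally show ?thesis
    by (simp only: nat_le_iff)
qed

lemma two_times_choose_two: "2 * (Suc n choose 2) = n * (n + 1)"
  by (simp add: choose_two)

text \<open>The arithmetic-geometric mean inequality without division: the difference of the two
  sides is \<open>(p - q)\<^sup>2\<close>, taken over \<open>int\<close> to avoid truncated
  subtraction.\<close>

lemma four_mult_le_square_add:
  fixes p q :: nat
  shows "4 * (p * q) \<le> (p + q)\<^sup>2"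
proof -
  have "0 \<le> (int p - int q)\<^sup>2"
    by simp
  then have "int (4 * (p * q)) \<le> int ((p + q)\<^sup>2)"
    by (simp add: power2_eq_square algebra_simps)
  then show ?thesis
    by linarith
qed

text \<open>One of the two squares is divisible by 4 and the other leaves remainder 1. This closed
  form makes the lower bound independent of the parity of \<open>n\<close>.\<close>

lemma quarter_squares_sum:
  fixes n :: nat
  assumes "n > 0"
  shows "2 * ((n - 1)\<^sup>2 div 4) + 2 * (n\<^sup>2 div 4) = n * (n - 1)"
proof (cases "even n")
  case True
  then obtain k where k: "n = 2 * Suc k"
    using assms by (metis evenE gr0_conv_Suc mult_0_right not_gr_zero)
  have "(n - 1)\<^sup>2 = 4 * (k * k + k) + 1" "n\<^sup>2 = 4 * (Suc k * Suc k)"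
    by (simp_all add: k power2_eq_square algebra_simps)
  then have "(n - 1)\<^sup>2 div 4 = k * k + k" "n\<^sup>2 div 4 = Suc k * Suc k"
    by simp_all
  then show ?thesis
    by (simp add: k algebra_simps)
next
  case False
  then obtain k where k: "n = 2 * k + 1"
    by (auto elim: oddE)
  have "(n - 1)\<^sup>2 = 4 * (k * k)" "n\<^sup>2 = 4 * (k * k + k) + 1"
    by (simp_all add: k power2_eq_square algebra_simps)
  then have "(n - 1)\<^sup>2 div 4 = k * k" "n\<^sup>2 div 4 = k * k + k"
    by simp_all
  then show ?thesis
    by (simp add: k algebra_simps)
qed

section \<open>Lower bound for labellings of the square board\<close>

lemma exists_initial_subset:
  fixes g :: "'a \<Rightarrow> 'b::linorder"
  assumes "finite C" "inj_on g C" "l \<le> card C"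
  shows "\<exists>S \<subseteq> C. card S = l \<and> (\<forall>x \<in> S. \<forall>y \<in> C - S. g x < g y)"
  using assms(3)
proof (induction l)
  case 0
  show ?case
    by (rule exI[of _ "{}"]) simp
next
  case (Suc l)
  then obtain S where S: "S \<subseteq> C" "card S = l" "\<forall>x \<in> S. \<forall>y \<in> C - S. g x < g y"
    by auto
  have fin: "finite S" "finite (C - S)"
    using S(1) assms(1) finite_subset by auto
  have "C - S \<noteq> {}"
    using S Suc.prems fin by (metis Diff_eq_empty_iff card_mono not_less_eq_eq)
  then obtain z where z: "z \<in> C - S" "\<forall>y \<in> C - S. g z \<le> g y"
    using fin(2) by (metis arg_min_least arg_min_if_finite(1))
  have "g z < g y" if "y \<in> C - insert z S" for y
    using z that assms(2) by (metis Diff_iff inj_onD insert_iff order_le_less)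
  then have "\<forall>x \<in> insert z S. \<forall>y \<in> C - insert z S. g x < g y"
    using S(3) by auto
  moreover have "card (insert z S) = Suc l" "insert z S \<subseteq> C"
    using z S fin by auto
  ultimately show ?case
    by blast
qed

lemma board_labelling_spread:
  fixes g :: "nat \<times> nat \<Rightarrow> int" and n d :: nat
  assumes n: "n > 0"
    and inj: "inj_on g ({..<n} \<times> {..<n})"
    and row: "\<And>i j j'. \<lbrakk>i < n; j < n; j' < n\<rbrakk> \<Longrightarrow> \<bar>g (i, j) - g (i, j')\<bar> \<le> int d"
    and col: "\<And>i i' j. \<lbrakk>i < n; i' < n; j < n\<rbrakk> \<Longrightarrow> \<bar>g (i, j) - g (i', j)\<bar> \<le> int d"
  shows "n * (n + 1) \<le> 2 * d + 2"
proof -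
  define C where "C = {..<n} \<times> {..<n}"
  \<comment> \<open>The least integer exceeding (n-1)^2/4, hence too many cells for a set of lines
    with at most n-1 rows and columns in total.\<close>
  define l where "l = (n - 1)\<^sup>2 div 4 + 1"
  have card_C: "card C = n * n" and fin_C: "finite C"
    by (simp_all add: C_def)
  have "l \<le> n * n"
  proof -
    obtain m where "n = Suc m"
      using n gr0_conv_Suc by blast
    then show ?thesis
      unfolding l_def power2_eq_square by (simp add: le_trans[OF div_le_dividend])
  qed
  then obtain S where S: "S \<subseteq> C" "card S = l" "\<forall>x \<in> S. \<forall>y \<in> C - S. g x < g y"
    using exists_initial_subset[OF fin_C, of g l] inj by (auto simp: C_def)
  have fin_S: "finite S"
    using S(1) fin_C finite_subset by blast
  define R where "R = fst ` S"
  define K where "K = snd ` S"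
  have RK: "R \<subseteq> {..<n}" "K \<subseteq> {..<n}" "finite R" "finite K"
    using S(1) fin_S by (auto simp: R_def K_def C_def)
  have "S \<subseteq> R \<times> K"
    by (force simp: R_def K_def)
  then have l_le: "l \<le> card R * card K"
    using S(2) RK by (metis card_cartesian_product card_mono finite_cartesian_product)
  have rn: "card R \<le> n" "card K \<le> n"
    using RK by (metis card_lessThan card_mono finite_lessThan)+
  have sum_ge: "n \<le> card R + card K"
  proof (rule ccontr)
    assume "\<not> ?thesis"
    then have "(card R + card K)\<^sup>2 \<le> (n - 1)\<^sup>2"
      by (intro power_mono) auto
    then show False
      using l_le four_mult_le_square_add[of "card R" "card K"] unfolding l_def by linarith
  qed
  define W where "W = ({..<n} - R) \<times> ({..<n} - K)"
  have card_W: "card W \<le> n\<^sup>2 div 4"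
  proof -
    have "card W = (n - card R) * (n - card K)"
      using RK by (simp add: W_def card_cartesian_product card_Diff_subset)
    \<comment> \<open>The numbers of missed rows and missed columns add up to at most n, so their
      product is at most n^2/4.\<close>
    moreover have "((n - card R) + (n - card K))\<^sup>2 \<le> n\<^sup>2"
      using sum_ge rn by (intro power_mono) auto
    ultimately show ?thesis
      using four_mult_le_square_add[of "n - card R" "n - card K"] by linarith
  qed
  \<comment> \<open>The cells outside \<open>S\<close> that share a line with some cell of
    \<open>S\<close>; the cells of \<open>W\<close> share none.\<close>
  define M where "M = C - W - S"
  have fin_M: "finite M"
    using fin_C by (simp add: M_def)
  have "card C \<le> card (W \<union> S \<union> M)"
    using fin_S fin_M by (intro card_mono) (auto simp: M_def W_def)
  also have "\<dots> \<le> card W + card S + card M"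
    using card_Un_le[of "W \<union> S" M] card_Un_le[of W S] by linarith
  finally have card_M: "n * n \<le> n\<^sup>2 div 4 + l + card M"
    using card_C card_W S(2) by linarith
  have "card M \<le> d"
  proof (cases "M = {}")
    case False
    then have "Max (g ` M) \<in> g ` M"
      using fin_M by simp
    then obtain y where y: "y \<in> M" "g y = Max (g ` M)"
      by auto
    have y_max: "g z \<le> g y" if "z \<in> M" for z
      using fin_M that by (simp add: y(2))
    obtain a b where ab: "y = (a, b)" "a < n" "b < n" "a \<in> R \<or> b \<in> K"
      using y(1) by (cases y) (auto simp: M_def W_def C_def)
    obtain x where x: "x \<in> S" "fst x = a \<or> snd x = b"
      using ab(4) by (auto simp: R_def K_def)
    have "x \<in> C"
      using x(1) S(1) by blast
    then have "g y - g x \<le> int d"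
      using x(2) ab row[of a b "snd x"] col[of a "fst x" b] by (cases x) (auto simp: C_def)
    \<comment> \<open>Cells of \<open>M\<close> lie outside the initial set \<open>S\<close>, so
      their labels exceed \<open>g x\<close>. Being distinct integers, they number at most
      \<open>g y - g x\<close>.\<close>
    moreover have "g ` M \<subseteq> {g x <.. g y}"
      using y_max x(1) S(3) by (auto simp: M_def)
    then have "card (g ` M) \<le> card {g x <.. g y}"
      by (intro card_mono) auto
    moreover have "card (g ` M) = card M"
      using inj by (intro card_image) (auto intro: inj_on_subset simp: M_def C_def)
    ultimately show ?thesis
      by simp
  qed simp
  moreover have "2 * l + 2 * (n\<^sup>2 div 4) = n * (n - 1) + 2"
    using quarter_squares_sum[OF n] by (simp add: l_def)
  moreover have "n * (n - 1) + n = n * n"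
    using n by (cases n) auto
  ultimately show ?thesis
    using card_M by (simp add: distrib_left)
qed

section \<open>The block numbering and its row and column spreads\<close>

text \<open>The board has side \<open>2 * k + e\<close> with \<open>e \<in> {0, 1}\<close>.\<close>

definition block_label :: "nat \<Rightarrow> nat \<Rightarrow> nat \<Rightarrow> nat \<Rightarrow> nat" where
  "block_label k e i j =
    (if j < k then i * k + j + (if i < k then 0 else e * k)
     else if j < k + e then
       (if i < k then k * k + i else 3 * (k * k) + 2 * (e * k) + (i - k))
     else 2 * (k * k) + 2 * (e * k) + i * k + (j - k - e) + (if i < k then 0 else e * (k + e)))"

lemma row_major_less:
  fixes i j h k :: nat
  assumes "i < h" "j < k"
  shows "i * k + j < h * k"
proof -
  have "Suc i * k \<le> h * k"
    using assms(1) by (intro mult_right_mono) auto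
  then show ?thesis
    using assms(2) by simp
qed

lemma row_major_eq_iff:
  fixes i j i' j' k :: nat
  assumes "j < k" "j' < k"
  shows "i * k + j = i' * k + j' \<longleftrightarrow> i = i' \<and> j = j'"
proof
  assume eq: "i * k + j = i' * k + j'"
  then have "(i * k + j) div k = (i' * k + j') div k"
    by simp
  then have "i = i'"
    using assms by simp
  then show "i = i' \<and> j = j'"
    using eq by simp
qed simp

lemma inj_on_block_label:
  assumes e: "e \<le> 1"
  shows "inj_on (\<lambda>(i, j). block_label k e i j) ({..<2 * k + e} \<times> {..<2 * k + e})"
proof -
  \<comment> \<open>\<open>b\<close> is the position of the block of a cell in the numbering order,
    and \<open>off t\<close> is the first label of block \<open>t\<close>; \<open>off 6\<close> is
    the end of all labels. Blocks thus get disjoint intervals, and injectivity need only be checked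
    inside one block.\<close>
  define b :: "nat \<Rightarrow> nat \<Rightarrow> nat" where
    "b i j = (if j < k then (if i < k then 0 else 2)
       else if j < k + e then (if i < k then 1 else 4) else (if i < k then 3 else 5))" for i j
  define off :: "nat \<Rightarrow> nat" where
    "off t = (if t = 0 then 0 else if t = 1 then k * k else if t = 2 then k * k + e * k
       else if t = 3 then 2 * (k * k) + 2 * (e * k) else if t = 4 then 3 * (k * k) + 2 * (e * k)
       else if t = 5 then 3 * (k * k) + 2 * (e * k) + e * (k + e)
       else 3 * (k * k) + 2 * (e * k) + e * (k + e) + (k + e) * k)" for t
  have off_mono: "off s \<le> off t" if "s \<le> t" for s t
    using that by (auto simp: off_def algebra_simps)
  have block: "off (b i j) \<le> block_label k e i j \<and> block_label k e i j < off (Suc (b i j))"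
    if lt: "i < 2 * k + e" "j < 2 * k + e" for i j
  proof -
    \<comment> \<open>With the products \<open>i * k\<close> and \<open>k * k\<close> named and
      \<open>e\<close> fixed to 0 or 1, all block inequalities become linear.\<close>
    define p q where "p = i * k" and "q = k * k"
    note pq = p_def[symmetric] q_def[symmetric]
    have 1: "p + k \<le> q" if "i < k"
      using mult_right_mono[of "Suc i" k k] that by (simp add: p_def q_def)
    have 2: "q \<le> p" if "k \<le> i"
      using mult_right_mono[of k i k] that by (simp add: p_def q_def)
    have 3: "p + k \<le> 2 * q + e * k"
      using mult_right_mono[of "Suc i" "2 * k + e" k] lt by (simp add: p_def q_def algebra_simps)
    have "e = 0 \<or> e = 1"
      using e by auto
    then show ?thesis
    proof
      assume e: "e = 0"
      show ?thesis
        using lt 1 2 3 by (auto simp: e pq b_def off_def block_label_def)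
    next
      assume e: "e = 1"
      show ?thesis
        using lt 1 2 3 by (auto simp: e pq b_def off_def block_label_def)
    qed
  qed
  have "i = i' \<and> j = j'"
    if lt: "i < 2 * k + e" "j < 2 * k + e" "i' < 2 * k + e" "j' < 2 * k + e"
      and eq: "block_label k e i j = block_label k e i' j'" for i j i' j'
  proof -
    have "b i j = b i' j'"
    proof (rule linorder_cases)
      assume "b i j < b i' j'"
      then show ?thesis
        using block[OF lt(1,2)] block[OF lt(3,4)] eq off_mono[of "Suc (b i j)" "b i' j'"] by simp
    next
      assume "b i' j' < b i j"
      then show ?thesis
        using block[OF lt(1,2)] block[OF lt(3,4)] eq off_mono[of "Suc (b i' j')" "b i j"] by simp
    qed
    then have zone: "(i < k) = (i' < k)" "(j < k) = (j' < k)" "(j < k + e) = (j' < k + e)"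
      by (auto simp: b_def split: if_splits)
    consider "j < k" | "k \<le> j" "j < k + e" | "k + e \<le> j"
      by linarith
    then show ?thesis
    proof cases
      case 1
      then show ?thesis
        using eq zone row_major_eq_iff[of j k j' i i'] by (auto simp: block_label_def)
    next
      case 2
      then show ?thesis
        using eq zone e by (auto simp: block_label_def split: if_splits)
    next
      case 3
      define c c' where "c = j - k - e" and "c' = j' - k - e"
      have j: "j = k + e + c" "j' = k + e + c'" "c < k" "c' < k"
        using 3 zone(3) lt by (auto simp: c_def c'_def)
      have "i * k + c = i' * k + c'"
        using eq zone(1) by (auto simp: j block_label_def split: if_splits)
      then show ?thesis
        using row_major_eq_iff[OF j(3,4)] j by auto
    qed
  qed
  then show ?thesis
    by (auto simp: inj_on_def)
qed

text \<open>\<open>m\<close> is the label of the first cell of the row, and the labels grow along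
  the row. The length of the window is n(n+1)/2 for n = 2k+e, and the rows from \<open>k\<close> on
  fill it from end to end.\<close>

lemma block_label_row_bounds:
  assumes e: "e \<le> 1" and lt: "i < 2 * k + e" "j < 2 * k + e"
  defines "m \<equiv> (if i < k then i * k else i * k + e * k)"
  shows "m \<le> block_label k e i j \<and> block_label k e i j < m + 2 * (k * k) + 2 * (e * k) + k + e"
proof -
  define p q where "p = i * k" and "q = k * k"
  note pq = p_def[symmetric] q_def[symmetric]
  have 1: "p + k \<le> q" if "i < k"
    using mult_right_mono[of "Suc i" k k] that by (simp add: p_def q_def)
  have 2: "q \<le> p" if "k \<le> i"
    using mult_right_mono[of k i k] that by (simp add: p_def q_def)
  have 3: "p + k \<le> 2 * q + e * k"
    using mult_right_mono[of "Suc i" "2 * k + e" k] lt by (simp add: p_def q_def algebra_simps)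
  have "e = 0 \<or> e = 1"
    using e by auto
  then show ?thesis
  proof
    assume e: "e = 0"
    show ?thesis
      using lt 1 2 3 by (auto simp: e pq m_def block_label_def)
  next
    assume e: "e = 1"
    show ?thesis
      using lt 1 2 3 by (auto simp: e pq m_def block_label_def)
  qed
qed

text \<open>\<open>m\<close> starts the upper block of the column. Left columns use only the first
  three blocks and right columns only blocks from the fourth on; the middle column runs from
  \<open>k * k\<close> to the last label of the fifth block, exactly the length of the
  window.\<close>

lemma block_label_column_bounds:
  assumes e: "e \<le> 1" and lt: "i < 2 * k + e" "j < 2 * k + e"
  defines "m \<equiv> (if j < k then 0 else if j < k + e then k * k else 2 * (k * k) + 2 * (e * k))"
  shows "m \<le> block_label k e i j \<and> block_label k e i j < m + 2 * (k * k) + 2 * (e * k) + k + e"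
proof -
  define p q where "p = i * k" and "q = k * k"
  note pq = p_def[symmetric] q_def[symmetric]
  have 1: "p + k \<le> q" if "i < k"
    using mult_right_mono[of "Suc i" k k] that by (simp add: p_def q_def)
  have 3: "p + k \<le> 2 * q + e * k"
    using mult_right_mono[of "Suc i" "2 * k + e" k] lt by (simp add: p_def q_def algebra_simps)
  have "e = 0 \<or> e = 1"
    using e by auto
  then show ?thesis
  proof
    assume e: "e = 0"
    show ?thesis
      using lt 1 3 by (auto simp: e pq m_def block_label_def)
  next
    assume e: "e = 1"
    show ?thesis
      using lt 1 3 by (auto simp: e pq m_def block_label_def)
  qed
qed

lemma exists_board_labelling:
  fixes n d :: nat
  assumes d: "2 * d + 2 = n * (n + 1)"
  obtains g :: "nat \<times> nat \<Rightarrow> int" where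
    "inj_on g ({..<n} \<times> {..<n})"
    "\<And>i j j'. \<lbrakk>i < n; j < n; j' < n\<rbrakk> \<Longrightarrow> \<bar>g (i, j) - g (i, j')\<bar> \<le> int d"
    "\<And>i i' j. \<lbrakk>i < n; i' < n; j < n\<rbrakk> \<Longrightarrow> \<bar>g (i, j) - g (i', j)\<bar> \<le> int d"
proof -
  define k where "k = n div 2"
  define e where "e = n mod 2"
  have n: "n = 2 * k + e" and e: "e \<le> 1"
    unfolding k_def e_def by auto
  have ee: "e * e = e"
    using e by (cases e) auto
  \<comment> \<open>Both window lengths equal \<open>d + 1\<close>, so two labels in one window
    differ by at most \<open>d\<close>.\<close>
  have d': "d + 1 = 2 * (k * k) + 2 * (e * k) + k + e"
    using d ee by (simp add: n algebra_simps)
  define g where "g = (\<lambda>(i, j). int (block_label k e i j))"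
  show ?thesis
  proof (rule that[of g])
    show "inj_on g ({..<n} \<times> {..<n})"
      using inj_on_block_label[OF e, of k] by (auto simp: g_def n inj_on_def)
    show "\<bar>g (i, j) - g (i, j')\<bar> \<le> int d" if "i < n" "j < n" "j' < n" for i j j'
      using block_label_row_bounds[OF e, of i k j] block_label_row_bounds[OF e, of i k j']
        that d' unfolding g_def n by simp linarith
    show "\<bar>g (i, j) - g (i', j)\<bar> \<le> int d" if "i < n" "i' < n" "j < n" for i i' j
      using block_label_column_bounds[OF e, of i k j] block_label_column_bounds[OF e, of i' k j]
        that d' unfolding g_def n by simp linarith
  qed
qed

section \<open>Translation between the board and the bipartite graph\<close>

lemma incident_edges_bipartite_iff:
  "incident_edges {Inl i, Inr j} {Inl i', Inr j'} \<longleftrightarrow>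
    (i, j) \<noteq> (i', j') \<and> (i = i' \<or> j = j')"
  by (auto simp: incident_edges_def doubleton_eq_iff)

lemma edge_numbering_complete_bipartite_iff:
  "edge_numbering (complete_bipartite m n) f \<longleftrightarrow>
    inj_on (\<lambda>(i, j). f {Inl i, Inr j}) ({..<m} \<times> {..<n})"
proof -
  let ?h = "\<lambda>(i, j). {Inl i, Inr j} :: (nat + nat) set"
  have "inj_on ?h ({..<m} \<times> {..<n})"
    by (auto simp: inj_on_def doubleton_eq_iff)
  then have "edge_numbering (complete_bipartite m n) f \<longleftrightarrow> inj_on (f \<circ> ?h) ({..<m} \<times> {..<n})"
    unfolding edge_numbering_def edges_complete_bipartite by (rule comp_inj_on_iff)
  moreover have "f \<circ> ?h = (\<lambda>(i, j). f {Inl i, Inr j})"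
    by auto
  ultimately show ?thesis
    by simp
qed

lemma numbering_width_complete_bipartite_le_iff:
  "numbering_width (complete_bipartite m n) f \<le> d \<longleftrightarrow>
    (\<forall>i j j'. i < m \<longrightarrow> j < n \<longrightarrow> j' < n \<longrightarrow>
       \<bar>f {Inl i, Inr j} - f {Inl i, Inr j'}\<bar> \<le> int d) \<and>
    (\<forall>i i' j. i < m \<longrightarrow> i' < m \<longrightarrow> j < n \<longrightarrow>
       \<bar>f {Inl i, Inr j} - f {Inl i', Inr j}\<bar> \<le> int d)" (is "?W \<longleftrightarrow> ?R \<and> ?C")
proof -
  note W = numbering_width_le_iff[OF finite_simple_graph_complete_bipartite]
  have edge: "{Inl i, Inr j} \<in> edges (complete_bipartite m n)" if "i < m" "j < n" for i j
    using that by (auto simp: edges_complete_bipartite)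
  have "?R \<and> ?C" if ?W
  proof (intro conjI allI impI)
    fix i j j' assume "i < m" "j < n" "j' < n"
    then show "\<bar>f {Inl i, Inr j} - f {Inl i, Inr j'}\<bar> \<le> int d"
      using \<open>?W\<close>[unfolded W, rule_format, OF edge edge, of i j i j']
      by (cases "j = j'") (simp_all add: incident_edges_bipartite_iff)
  next
    fix i i' j assume "i < m" "i' < m" "j < n"
    then show "\<bar>f {Inl i, Inr j} - f {Inl i', Inr j}\<bar> \<le> int d"
      using \<open>?W\<close>[unfolded W, rule_format, OF edge edge, of i j i' j]
      by (cases "i = i'") (simp_all add: incident_edges_bipartite_iff)
  qed
  moreover have ?W if RC: "?R \<and> ?C"
    unfolding W
  proof (intro ballI impI)
    fix x x'
    assume x: "x \<in> edges (complete_bipartite m n)" "x' \<in> edges (complete_bipartite m n)"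
      and inc: "incident_edges x x'"
    obtain i j where ij: "x = {Inl i, Inr j}" "i < m" "j < n"
      using x(1) by (auto simp: edges_complete_bipartite)
    obtain i' j' where ij': "x' = {Inl i', Inr j'}" "i' < m" "j' < n"
      using x(2) by (auto simp: edges_complete_bipartite)
    have "i = i' \<or> j = j'"
      using inc unfolding ij(1) ij'(1) incident_edges_bipartite_iff by blast
    then show "\<bar>f x - f x'\<bar> \<le> int d"
      using RC ij ij' by auto
  qed
  ultimately show ?thesis
    by blast
qed

theorem theorem14:
  fixes n :: nat
  assumes "n > 0"
  shows "edge_bandwidth (complete_bipartite n n) = ((n + 1) choose 2) - 1"
proof -
  let ?G = "complete_bipartite n n"
  define d where "d = ((n + 1) choose 2) - 1"
  \<comment> \<open>As \<open>n > 0\<close>, the binomial coefficient is positive and the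
    subtraction in \<open>d\<close> is not truncated.\<close>
  have d: "2 * d + 2 = n * (n + 1)"
    using two_times_choose_two[of n] assms unfolding d_def
    by (cases "Suc n choose 2") auto
  have lower: "d \<le> numbering_width ?G f" if "edge_numbering ?G f" for f
  proof -
    have "n * (n + 1) \<le> 2 * numbering_width ?G f + 2"
      using board_labelling_spread[OF assms, of "\<lambda>(i, j). f {Inl i, Inr j}" "numbering_width ?G f"]
        that numbering_width_complete_bipartite_le_iff[of n n f "numbering_width ?G f"]
      by (auto simp: edge_numbering_complete_bipartite_iff)
    then show ?thesis
      using d by linarith
  qed
  obtain g :: "nat \<times> nat \<Rightarrow> int" where g: "inj_on g ({..<n} \<times> {..<n})"
    "\<And>i j j'. \<lbrakk>i < n; j < n; j' < n\<rbrakk> \<Longrightarrow> \<bar>g (i, j) - g (i, j')\<bar> \<le> int d"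
    "\<And>i i' j. \<lbrakk>i < n; i' < n; j < n\<rbrakk> \<Longrightarrow> \<bar>g (i, j) - g (i', j)\<bar> \<le> int d"
    using exists_board_labelling[OF d] by blast
  \<comment> \<open>Each edge has exactly one left and one right endpoint, so \<open>THE\<close>
    recovers its cell; values off the edges are irrelevant.\<close>
  define f where "f x = g (THE i. Inl i \<in> x, THE j. Inr j \<in> x)" for x
  have f: "f {Inl i, Inr j} = g (i, j)" for i j
    by (simp add: f_def)
  have num: "edge_numbering ?G f"
    using g(1) by (simp add: edge_numbering_complete_bipartite_iff f)
  moreover have "numbering_width ?G f \<le> d"
    using g(2,3) by (simp add: numbering_width_complete_bipartite_le_iff f)
  ultimately have "numbering_width ?G f = d"
    using lower[OF num] by simp
  then have "edge_bandwidth ?G = d"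
    unfolding edge_bandwidth_def
    using num lower by (intro Least_equality) blast+
  then show ?thesis
    by (simp add: d_def)
qed

end
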